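(* Let $m$ be a positive integer. The ideal $I=(p_{1},p_{2m})$ is a prime ideal in $S=\mathbb{C}[x_1,x_2,x_3,x_4]$. Therefore, for every integer $n>2m$ with $p_n \notin (p_{1},p_{2m})$, the sequence $p_{1},p_{2m},p_n$ is a regular sequence in $S$.
   Context: For a positive integer $j$, $p_j = x_1^j+x_2^j+x_3^j+x_4^j$ is the power sum symmetric polynomial of degree $j$. A sequence $f_1,\dots,f_k$ in $S$ is a regular sequence if the ideal $(f_1,\dots,f_k)$ is proper and, for each $i$, the image of $f_{i+1}$ is a nonzerodivisor in $S/(f_1,\dots,f_i)$. *)

theory Defs
  imports "HOL-Algebra.Algebra" "HOL-Algebra.Algebraic_Closure_Type"
    "HOL-Computational_Algebra.Polynomial" Complex_Main
begin

text \<open>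
  The polynomial ring over the complex numbers in four variables is taken in its iterated form
  \<open>\<complex>[x\<^sub>1][x\<^sub>2][x\<^sub>3][x\<^sub>4]\<close>: the innermost indeterminate is \<open>x\<^sub>1\<close>, the outermost \<open>x\<^sub>4\<close>.
\<close>

type_synonym poly4 = "complex poly poly poly poly"

definition S :: "poly4 ring"
  where "S = ring_of_type_algebra"

definition x1 :: poly4 where "x1 = [:[:[:[:0, 1:]:]:]:]"
definition x2 :: poly4 where "x2 = [:[:[:0, 1:]:]:]"
definition x3 :: poly4 where "x3 = [:[:0, 1:]:]"
definition x4 :: poly4 where "x4 = [:0, 1:]"

definition power_sum :: "nat \<Rightarrow> poly4"
  where "power_sum j = x1 ^ j + x2 ^ j + x3 ^ j + x4 ^ j"

definition nonzerodivisor :: "('a, 'b) ring_scheme \<Rightarrow> 'a \<Rightarrow> bool"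
  where "nonzerodivisor R a \<longleftrightarrow>
    a \<in> carrier R \<and> (\<forall>b\<in>carrier R. a \<otimes>\<^bsub>R\<^esub> b = \<zero>\<^bsub>R\<^esub> \<longrightarrow> b = \<zero>\<^bsub>R\<^esub>)"

text \<open>
  Intended for commutative rings. Lists are indexed from 0, so \<open>fs ! i\<close> is the element
  \<open>f\<^sub>i\<^sub>+\<^sub>1\<close> and \<open>set (take i fs)\<close> is \<open>{f\<^sub>1, \<dots>, f\<^sub>i}\<close>; for \<open>i = 0\<close> the ideal is the zero ideal.
\<close>

definition regular_sequence :: "('a, 'b) ring_scheme \<Rightarrow> 'a list \<Rightarrow> bool"
  where "regular_sequence R fs \<longleftrightarrow>
    set fs \<subseteq> carrier R \<and>
    Idl\<^bsub>R\<^esub> (set fs) \<noteq> carrier R \<and>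
    (\<forall>i<length fs.
      nonzerodivisor (R Quot Idl\<^bsub>R\<^esub> (set (take i fs)))
        (Idl\<^bsub>R\<^esub> (set (take i fs)) +>\<^bsub>R\<^esub> fs ! i))"

end

theory Submission
  imports Defs
begin

text \<open>
  Put \<open>n = 2 * m\<close>. Modulo \<open>p\<^sub>1\<close> one may substitute \<open>x\<^sub>4 = - (x\<^sub>1 + x\<^sub>2 + x\<^sub>3)\<close>, so the quotient by
  \<open>p\<^sub>1\<close> is \<open>\<complex>[t\<^sub>1,t\<^sub>2,t\<^sub>3]\<close>, and \<open>p\<^sub>n\<close> becomes \<open>f = t\<^sub>1\<^sup>n + t\<^sub>2\<^sup>n + t\<^sub>3\<^sup>n + (t\<^sub>1 + t\<^sub>2 + t\<^sub>3)\<^sup>n\<close>. The ideal is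
  prime iff \<open>f\<close> is a prime element, and since the ring is factorial, irreducibility suffices.

  Geometrically, \<open>f = 0\<close> is a smooth plane curve: at a singular point the four coordinates
  \<open>x\<^sub>i\<close> have a common \<open>(n - 1)\<close>-th power, so up to scaling they are \<open>(n - 1)\<close>-th roots of unity
  with sum zero. Four unit complex numbers with sum zero cancel in opposite pairs, which is
  impossible because \<open>n - 1\<close> is odd. Two components of a reducible plane curve would meet,
  and meet in a singular point.

  The appeal to intersection theory is replaced by an explicit descent. Suppose \<open>f = g * h\<close>
  with non-units \<open>g, h\<close>. All partial derivatives of \<open>f\<close> lie in the ideal \<open>(g, h)\<close>. Smoothness in the
  algebraic form \<open>line_in_radical_of_partials\<close> gives \<open>l\<^sup>N \<in> (g, h)\<close> for the linear form
  \<open>l = t\<^sub>1 + t\<^sub>3\<close>. The restriction of \<open>f\<close> to the line \<open>l = 0\<close> is \<open>2 * (t\<^sub>1\<^sup>n + t\<^sub>2\<^sup>n)\<close>, which is squarefree, so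
  \<open>g\<close> and \<open>h\<close> are coprime modulo \<open>l\<close>; this allows one to cancel one factor \<open>l\<close> at a time
  (\<open>comaximal_if_line_power_in_ideal\<close>) until \<open>1 \<in> (g, h)\<close>. But both factors vanish at the origin
  (\<open>factor_vanishes_at_origin\<close>), a contradiction.

  Regularity follows from primality: \<open>(0)\<close>, \<open>(p\<^sub>1)\<close> and \<open>(p\<^sub>1, p\<^sub>n)\<close> are prime ideals, and an element
  outside a prime ideal is a nonzerodivisor in the quotient.
\<close>

section \<open>Derivations of polynomial rings\<close>

definition derivation :: "('a::comm_ring_1 \<Rightarrow> 'a) \<Rightarrow> bool"
  where "derivation D \<longleftrightarrow>
    (\<forall>p q. D (p + q) = D p + D q) \<and> (\<forall>p q. D (p * q) = D p * q + p * D q)"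

lemma derivation_add: "derivation D \<Longrightarrow> D (p + q) = D p + D q"
  and derivation_mult: "derivation D \<Longrightarrow> D (p * q) = D p * q + p * D q"
  by (auto simp: derivation_def)

lemma derivation_0: "derivation D \<Longrightarrow> D 0 = 0"
  using derivation_add[of D 0 0] by simp

lemma derivation_1: "derivation D \<Longrightarrow> D 1 = 0"
  using derivation_mult[of D 1 1] by simp

lemma derivation_sum:
  "derivation D \<Longrightarrow> D (sum f A) = (\<Sum>i\<in>A. D (f i))"
  by (induction A rule: infinite_finite_induct) (auto simp: derivation_0 derivation_add)

lemma derivation_power:
  assumes "derivation D"
  shows "D (p ^ n) = of_nat n * p ^ (n - 1) * D p"
proof (induction n)
  case 0
  show ?case using assms by (simp add: derivation_1)
next
  case (Suc n)
  show ?case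
  proof (cases n)
    case 0
    then show ?thesis by simp
  next
    case (Suc k)
    have "D (p ^ Suc n) = D p * p ^ n + p * D (p ^ n)"
      using assms by (simp add: derivation_mult)
    then show ?thesis
      unfolding Suc.IH using Suc by (simp add: algebra_simps)
  qed
qed

lemma derivation_pderiv: "derivation (pderiv :: 'a::idom poly \<Rightarrow> 'a poly)"
  by (simp add: derivation_def pderiv_add pderiv_mult algebra_simps)

text \<open>
  Partial derivatives with respect to the inner variables of an iterated polynomial ring act
  on coefficients; this lemma makes them available as derivations.
\<close>

lemma derivation_map_poly:
  assumes "derivation D"
  shows "derivation (map_poly D)"
proof -
  note D = assms derivation_0[OF assms]
  have "map_poly D (p * q) = map_poly D p * q + p * map_poly D q" for p q
    by (rule poly_eqI)
       (simp add: coeff_map_poly D coeff_mult derivation_sum derivation_mult sum.distrib)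
  moreover have "map_poly D (p + q) = map_poly D p + map_poly D q" for p q
    by (rule poly_eqI) (simp add: coeff_map_poly D derivation_add)
  ultimately show ?thesis
    by (simp add: derivation_def)
qed

section \<open>Radical membership\<close>

text \<open>
  Membership of \<open>l\<close> in the radical of the ideal \<open>(a, b, c)\<close>, with explicit cofactors.
\<close>

definition in_radical :: "'a::comm_ring_1 \<Rightarrow> 'a \<Rightarrow> 'a \<Rightarrow> 'a \<Rightarrow> bool"
  where "in_radical l a b c \<longleftrightarrow> (\<exists>N A B C. l ^ N = A * a + B * b + C * c)"

lemma in_radical_rotate: "in_radical l a b c \<Longrightarrow> in_radical l b c a"
  unfolding in_radical_def by (metis add.assoc add.commute)

text \<open>
  A prime containing \<open>a * a'\<close> contains one of the factors; the proof without primes multiplies the two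
  representations: every term of the product except that of the two first terms lies in \<open>(b, c)\<close>.
\<close>

lemma in_radical_mult:
  assumes "in_radical l a b c" "in_radical l a' b c"
  shows "in_radical l (a * a') b c"
proof -
  obtain N A B C where 1: "l ^ N = A * a + B * b + C * c"
    using assms(1) by (auto simp: in_radical_def)
  obtain M A' B' C' where 2: "l ^ M = A' * a' + B' * b + C' * c"
    using assms(2) by (auto simp: in_radical_def)
  have "l ^ (N + M) = (A * A') * (a * a') + (A * a * B' + B * l ^ M) * b
          + (A * a * C' + C * l ^ M) * c"
    unfolding power_add 1 2 by (simp add: algebra_simps)
  then show ?thesis
    unfolding in_radical_def by blast
qed

lemma in_radical_prod:
  assumes "\<And>i. i \<in> I \<Longrightarrow> in_radical l (a i) b c"
  shows "in_radical l (\<Prod>i\<in>I. a i) b c"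
  using assms
proof (induction I rule: infinite_finite_induct)
  case (insert i I)
  then show ?case by (simp add: in_radical_mult)
next
  case (infinite I)
  have "l ^ 0 = 1 * prod a I + 0 * b + 0 * c"
    using infinite by simp
  then show ?case
    unfolding in_radical_def by blast
next
  case empty
  have "l ^ 0 = 1 * prod a {} + 0 * b + 0 * c"
    by simp
  then show ?case
    unfolding in_radical_def by blast
qed

lemma in_radical_prod3:
  assumes "\<And>i j k. i \<in> I \<Longrightarrow> j \<in> I \<Longrightarrow> k \<in> I \<Longrightarrow> in_radical l (a i) (b j) (c k)"
  shows "in_radical l (\<Prod>i\<in>I. a i) (\<Prod>j\<in>I. b j) (\<Prod>k\<in>I. c k)"
  by (intro in_radical_prod in_radical_rotate[OF in_radical_prod]
        in_radical_rotate[OF in_radical_rotate[OF in_radical_prod]] assms)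

section \<open>Roots of unity\<close>

text \<open>
  For unit numbers conjugation is inversion. Hence conjugating the relation shows that
  the second and third elementary symmetric functions of \<open>a, b, c\<close> cancel, while the relation
  itself says that the first one is \<open>- 1\<close>. So \<open>(1 + a) * (1 + b) * (1 + c) = 0\<close>.
\<close>

lemma unit_complex_sum_eq_0:
  fixes a b c :: complex
  assumes "norm a = 1" "norm b = 1" "norm c = 1" "1 + a + b + c = 0"
  shows "a = -1 \<or> b = -1 \<or> c = -1"
proof -
  have inv: "a * cnj a = 1" "b * cnj b = 1" "c * cnj c = 1"
    using assms(1-3) by (simp_all add: complex_norm_square[symmetric])
  have "1 + cnj a + cnj b + cnj c = 0"
    using arg_cong[OF assms(4), of cnj] by simp
  then have "a * b * c * (1 + cnj a + cnj b + cnj c) = 0"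
    by simp
  also have "a * b * c * (1 + cnj a + cnj b + cnj c)
      = a * b * c + (a * cnj a) * b * c + (b * cnj b) * a * c + (c * cnj c) * a * b"
    by (simp add: algebra_simps)
  finally have "a * b * c + b * c + a * c + a * b = 0"
    by (simp add: inv)
  moreover have "(1 + a) * (1 + b) * (1 + c)
      = (1 + a + b + c) + (a * b * c + b * c + a * c + a * b)"
    by (simp add: algebra_simps)
  ultimately have "(1 + a) * (1 + b) * (1 + c) = 0"
    using assms(4) by simp
  then show ?thesis
    by (auto simp: add_eq_0_iff)
qed

lemma odd_roots_of_unity_sum_neq_0:
  fixes a b c :: complex
  assumes "odd k" "a ^ k = 1" "b ^ k = 1" "c ^ k = 1"
  shows "1 + a + b + c \<noteq> 0"
proof
  assume sum: "1 + a + b + c = 0"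
  have k: "k > 0"
    using \<open>odd k\<close> by (auto intro: Nat.gr0I)
  have nrm: "norm z = 1" if "z ^ k = 1" for z :: complex
    using that k by (metis norm_ge_zero norm_one norm_power power_eq_1_iff real_norm_def less_imp_neq abs_norm_cancel)
  have "z \<noteq> -1" if "z ^ k = 1" for z :: complex
    using that \<open>odd k\<close> by auto
  with unit_complex_sum_eq_0[OF nrm nrm nrm sum] assms show False
    by blast
qed

text \<open>
  The map \<open>\<iota>\<close> embeds the complex roots of unity in the domain; the \<open>\<iota> \<zeta> * w\<close> are then
  \<open>k\<close> distinct roots of the monic polynomial \<open>T\<^sup>k - w\<^sup>k\<close>.
\<close>

lemma power_diff_power_eq_prod:
  fixes x w :: "'a::idom" and \<iota> :: "complex \<Rightarrow> 'a"
  assumes k: "k > 0" and w: "w \<noteq> 0"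
    and inj: "inj \<iota>" and one: "\<iota> 1 = 1" and mult: "\<And>a b. \<iota> (a * b) = \<iota> a * \<iota> b"
  shows "x ^ k - w ^ k = (\<Prod>\<zeta>\<in>{\<zeta>. \<zeta> ^ k = 1}. x - \<iota> \<zeta> * w)"
proof -
  define U where "U = {\<zeta>::complex. \<zeta> ^ k = 1}"
  define p where "p = monom 1 k - [:w ^ k:]"
  define q where "q = (\<Prod>\<zeta>\<in>U. [:- (\<iota> \<zeta> * w), 1:])"
  have U: "finite U" "card U = k"
    using k card_roots_unity_eq[OF k] by (auto simp: U_def intro!: finite_roots_unity)
  have pow: "\<iota> (a ^ j) = \<iota> a ^ j" for a j
    by (induction j) (simp_all add: one mult)
  have degq: "degree q = k"
    unfolding q_def by (subst degree_prod_eq_sum_degree) (auto simp: U)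
  have "p = q"
  proof (rule poly_eqI_degree_lead_coeff[where n = k and A = "(\<lambda>\<zeta>. \<iota> \<zeta> * w) ` U"])
    have "lead_coeff q = 1"
      unfolding q_def by (simp add: lead_coeff_prod)
    then show "coeff p k = coeff q k"
      using k degq by (cases k) (simp_all add: p_def)
    show "card ((\<lambda>\<zeta>. \<iota> \<zeta> * w) ` U) \<ge> k"
      using U inj w by (subst card_image) (auto simp: inj_on_def)
    show "degree p \<le> k"
      unfolding p_def by (intro degree_diff_le) (auto simp: degree_monom_le)
    show "degree q \<le> k"
      by (simp add: degq)
    fix z assume "z \<in> (\<lambda>\<zeta>. \<iota> \<zeta> * w) ` U"
    then obtain \<zeta> where \<zeta>: "\<zeta> \<in> U" "z = \<iota> \<zeta> * w"
      by blast
    have "poly p z = \<iota> (\<zeta> ^ k) * w ^ k - w ^ k"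
      by (simp add: p_def poly_monom \<zeta> power_mult_distrib pow)
    also have "\<dots> = 0"
      using \<zeta>(1) by (simp add: U_def one)
    also have "0 = poly q z"
      using \<zeta> U by (auto simp: q_def poly_prod)
    finally show "poly p z = poly q z" .
  qed
  then have "poly p x = poly q x"
    by simp
  then show ?thesis
    by (simp add: p_def q_def poly_monom poly_prod U_def algebra_simps)
qed

section \<open>The plane curve cut out by an even power sum\<close>

type_synonym poly3 = "complex poly poly poly"

text \<open>
  Coordinates on the hyperplane \<open>x\<^sub>1 + x\<^sub>2 + x\<^sub>3 + x\<^sub>4 = 0\<close>. With \<open>t3\<close> outermost, reduction modulo
  \<open>t1 + t3\<close> is evaluation at \<open>- t1\<close>.
\<close>

definition t1 :: poly3 where "t1 = [:[:[:0, 1:]:]:]"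
definition t2 :: poly3 where "t2 = [:[:0, 1:]:]"
definition t3 :: poly3 where "t3 = [:0, 1:]"

definition scalar :: "complex \<Rightarrow> poly3" where "scalar a = [:[:[:a:]:]:]"

definition curve :: "nat \<Rightarrow> poly3"
  where "curve n = t1 ^ n + t2 ^ n + t3 ^ n + (t1 + t2 + t3) ^ n"

lemma scalar_add: "scalar (a + b) = scalar a + scalar b"
  and scalar_mult: "scalar (a * b) = scalar a * scalar b"
  and scalar_1: "scalar 1 = 1"
  by (simp_all add: scalar_def one_pCons)

lemma inj_scalar: "inj scalar"
  by (auto simp: inj_def scalar_def)

lemma coordinate_sum_neq_0: "t1 + t2 + t3 \<noteq> 0"
  by (simp add: t1_def t2_def t3_def)

text \<open>
  Up to the factor \<open>k + 1\<close> the three polynomials are the partial derivatives of \<open>curve (k + 1)\<close>.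
  With \<open>w = - (t1 + t2 + t3)\<close> and \<open>k\<close> odd they are \<open>t1\<^sup>k - w\<^sup>k\<close>, \<open>t2\<^sup>k - w\<^sup>k\<close>, \<open>t3\<^sup>k - w\<^sup>k\<close>, products of
  linear forms. It is enough to treat one linear factor of each: modulo \<open>t1 - a * w\<close>,
  \<open>t2 - b * w\<close>, \<open>t3 - c * w\<close> the relation \<open>t1 + t2 + t3 + w = 0\<close> reads \<open>(1 + a + b + c) * w = 0\<close>, so
  \<open>w\<close> and every other linear form vanishes. The line \<open>t1 + t3 = 0\<close> is singled out because the curve
  meets it in distinct points.
\<close>

lemma line_in_radical_of_partials:
  assumes "odd k"
  shows "in_radical (t1 + t3) (t1 ^ k + (t1 + t2 + t3) ^ k) (t2 ^ k + (t1 + t2 + t3) ^ k)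
           (t3 ^ k + (t1 + t2 + t3) ^ k)"
proof -
  define w where "w = - (t1 + t2 + t3)"
  have sum0: "t2 = - t1 - t3 - w"
    by (simp add: w_def)
  have k: "k > 0"
    using \<open>odd k\<close> by (auto intro: Nat.gr0I)
  have w: "w \<noteq> 0"
    using coordinate_sum_neq_0 by (simp only: w_def neg_equal_0_iff_equal not_False_eq_True)
  have fac: "P ^ k + (t1 + t2 + t3) ^ k = (\<Prod>\<zeta>\<in>{\<zeta>. \<zeta> ^ k = 1}. P - scalar \<zeta> * w)" for P
  proof -
    have "P ^ k + (t1 + t2 + t3) ^ k = P ^ k - w ^ k"
      unfolding w_def using power_minus_odd[OF \<open>odd k\<close>, of "t1 + t2 + t3"] by simp
    then show ?thesis
      using power_diff_power_eq_prod[OF k w inj_scalar scalar_1 scalar_mult, of P] by simp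
  qed
  show ?thesis
    unfolding fac
  proof (rule in_radical_prod3; clarsimp)
    fix a b c :: complex
    assume "a ^ k = 1" "b ^ k = 1" "c ^ k = 1"
    define t where "t = 1 + a + b + c"
    have t: "t \<noteq> 0"
      unfolding t_def by (rule odd_roots_of_unity_sum_neq_0) fact+
    \<comment> \<open>\<open>t1 + t3\<close> is \<open>(a + c) * w\<close> modulo the three forms, and minus their sum is \<open>t * w\<close>:
      subtracting \<open>r\<close> times that sum cancels the remaining multiple of \<open>w\<close>.\<close>
    define r where "r = scalar ((a + c) / t)"
    have st: "scalar t = 1 + scalar a + scalar b + scalar c"
      by (simp add: t_def scalar_add scalar_1)
    have "r * scalar t = scalar (a + c)"
      using t by (simp add: r_def scalar_mult[symmetric])
    then have rt: "r * (1 + scalar a + scalar b + scalar c) = scalar a + scalar c"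
      by (simp add: st scalar_add)
    have "(1 - r) * (t1 - scalar a * w) + (- r) * (t2 - scalar b * w)
            + (1 - r) * (t3 - scalar c * w)
          = t1 + t3 + (r * (1 + scalar a + scalar b + scalar c) - (scalar a + scalar c)) * w"
      unfolding sum0 by (simp add: algebra_simps)
    then have "(t1 + t3) ^ 1 = (1 - r) * (t1 - scalar a * w) + (- r) * (t2 - scalar b * w)
            + (1 - r) * (t3 - scalar c * w)"
      by (simp add: rt)
    then show "in_radical (t1 + t3) (t1 - scalar a * w) (t2 - scalar b * w) (t3 - scalar c * w)"
      unfolding in_radical_def by blast
  qed
qed

text \<open>
  The product rule puts every derivative of \<open>g * h\<close> into the ideal \<open>(g, h)\<close>. The last
  hypothesis says that \<open>D\<close> is the partial derivative with respect to the coordinate \<open>V\<close>.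
\<close>

lemma partial_in_factor_ideal:
  assumes D: "derivation D" and n: "n > 0" and f: "curve n = g * h"
    and V: "(D t1, D t2, D t3, V) \<in> {(1, 0, 0, t1), (0, 1, 0, t2), (0, 0, 1, t3)}"
  shows "\<exists>A B. V ^ (n - 1) + (t1 + t2 + t3) ^ (n - 1) = A * g + B * h"
proof -
  have DS: "D (curve n) = of_nat n * (V ^ (n - 1) + (t1 + t2 + t3) ^ (n - 1))"
    using V by (auto simp: curve_def derivation_add[OF D] derivation_power[OF D] algebra_simps)
  define u where "u = scalar (1 / of_nat n)"
  have "u * of_nat n = 1"
    using n by (simp add: u_def scalar_def of_nat_poly one_pCons)
  then have "V ^ (n - 1) + (t1 + t2 + t3) ^ (n - 1) = u * D (curve n)"
    unfolding DS by (simp add: mult.assoc[symmetric])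
  also have "\<dots> = (u * D h) * g + (u * D g) * h"
    unfolding f by (simp add: derivation_mult[OF D] algebra_simps)
  finally show ?thesis by blast
qed

lemma line_in_radical_of_factors:
  assumes n: "even n" "n > 0" and f: "curve n = g * h"
  shows "\<exists>N A B. (t1 + t3) ^ N = A * g + B * h"
proof -
  let ?s = "(t1 + t2 + t3) ^ (n - 1)"
  have D: "derivation (map_poly (map_poly pderiv) :: poly3 \<Rightarrow> poly3)"
      "derivation (map_poly pderiv :: poly3 \<Rightarrow> poly3)" "derivation (pderiv :: poly3 \<Rightarrow> poly3)"
    by (intro derivation_map_poly derivation_pderiv)+
  have "\<exists>A B. t1 ^ (n - 1) + ?s = A * g + B * h"
    by (rule partial_in_factor_ideal[OF D(1) n(2) f])
       (simp add: t1_def t2_def t3_def map_poly_pCons map_poly_1 pderiv_pCons one_pCons)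
  moreover have "\<exists>A B. t2 ^ (n - 1) + ?s = A * g + B * h"
    by (rule partial_in_factor_ideal[OF D(2) n(2) f])
       (simp add: t1_def t2_def t3_def map_poly_pCons map_poly_1 pderiv_pCons one_pCons)
  moreover have "\<exists>A B. t3 ^ (n - 1) + ?s = A * g + B * h"
    by (rule partial_in_factor_ideal[OF D(3) n(2) f])
       (simp add: t1_def t2_def t3_def map_poly_pCons map_poly_1 pderiv_pCons one_pCons)
  ultimately obtain A B A' B' A'' B'' where
    gh: "t1 ^ (n - 1) + ?s = A * g + B * h" "t2 ^ (n - 1) + ?s = A' * g + B' * h"
        "t3 ^ (n - 1) + ?s = A'' * g + B'' * h"
    by blast
  have "in_radical (t1 + t3) (t1 ^ (n - 1) + ?s) (t2 ^ (n - 1) + ?s) (t3 ^ (n - 1) + ?s)"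
    using n by (intro line_in_radical_of_partials) auto
  then obtain N P Q R where
    "(t1 + t3) ^ N = P * (A * g + B * h) + Q * (A' * g + B' * h) + R * (A'' * g + B'' * h)"
    unfolding in_radical_def gh by blast
  then have "(t1 + t3) ^ N = (P * A + Q * A' + R * A'') * g + (P * B + Q * B' + R * B'') * h"
    by (simp add: algebra_simps)
  then show ?thesis by blast
qed

section \<open>Irreducibility of the curve\<close>

text \<open>
  A common divisor \<open>c\<close> divides the form to the second order, hence also its derivative
  \<open>2 * n * y\<^sup>n\<^sup>-\<^sup>1\<close>, and therefore both \<open>y\<^sup>n\<^sup>-\<^sup>1\<close> and \<open>x\<^sup>n\<close>, which are coprime.
\<close>

lemma binary_form_factors_coprime:
  fixes g h :: "complex poly poly"
  defines "x \<equiv> [:[:0, 1:]:]" and "y \<equiv> [:0, 1:]"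
  assumes n: "n > 0" and gh: "g * h = 2 * (x ^ n + y ^ n)"
  shows "coprime g h"
proof (rule coprimeI)
  fix c assume "c dvd g" "c dvd h"
  then obtain g' h' where c: "g = c * g'" "h = c * h'"
    by (auto elim!: dvdE)
  let ?u = "[:[:1 / (2 * of_nat n):]:] :: complex poly poly"
  have D: "derivation (pderiv :: complex poly poly \<Rightarrow> _)"
    by (rule derivation_pderiv)
  have "pderiv (2 * (x ^ n + y ^ n)) = 2 * of_nat n * y ^ (n - 1)"
  proof -
    have "pderiv x = 0" "pderiv y = 1" "pderiv (2 :: complex poly poly) = 0"
      by (simp_all add: x_def y_def pderiv_pCons one_pCons numeral_poly)
    then show ?thesis
      by (simp only: derivation_mult[OF D] derivation_add[OF D] derivation_power[OF D]) simp
  qed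
  moreover have "?u * (2 * of_nat n) = 1"
    using n by (simp add: of_nat_poly numeral_poly one_pCons)
  ultimately have "y ^ (n - 1) = ?u * pderiv (2 * (x ^ n + y ^ n))"
    by (simp add: mult.assoc[symmetric])
  also have "\<dots> = c * (?u * (2 * pderiv c * g' * h' + c * pderiv (g' * h')))"
    unfolding gh[symmetric] c by (simp add: derivation_mult[OF D] algebra_simps)
  finally have y: "c dvd y ^ (n - 1)"
    by (rule dvdI)
  have "c dvd [:[:1 / 2:]:] * (g * h)"
    unfolding c by (rule dvd_mult, rule dvd_mult2, rule dvd_triv_left)
  also have "[:[:1 / 2:]:] * (g * h) = x ^ n + y ^ n"
    unfolding gh by (simp add: mult.assoc[symmetric] numeral_poly one_pCons[symmetric])
  finally have "c dvd x ^ n + y ^ n" .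
  moreover have "c dvd y ^ n"
    using y by (rule dvd_trans) (simp add: le_imp_power_dvd)
  ultimately have x: "c dvd x ^ n"
    by (simp add: dvd_add_left_iff)
  have "coprime x y"
  proof (rule coprimeI)
    fix d assume dx: "d dvd x" and dy: "d dvd y"
    have "degree d \<le> degree x"
      using dx by (rule dvd_imp_degree_le) (simp add: x_def)
    then have "degree d = 0"
      by (simp add: x_def)
    then obtain e where d: "d = [:e:]"
      by (rule degree_eq_zeroE)
    with dy have "e dvd 1"
      by (auto simp: y_def const_poly_dvd_iff coeff_pCons split: nat.splits dest: spec[of _ 1])
    then show "is_unit d"
      by (simp add: d is_unit_const_poly_iff)
  qed
  then have "coprime (x ^ n) (y ^ (n - 1))"
    by simp
  then show "is_unit c"
    using x y by (rule coprime_common_divisor)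
qed

text \<open>
  On \<open>t1 + t3 = 0\<close> the fourth coordinate is \<open>- t2\<close>, so the four powers agree in pairs.
\<close>

lemma curve_restricted_to_line:
  assumes "even n"
  shows "poly (curve n) (- [:[:0, 1:]:]) = 2 * ([:[:0, 1:]:] ^ n + [:0, 1:] ^ n)"
proof -
  have "poly t1 a = [:[:0, 1:]:]" "poly t2 a = [:0, 1:]" "poly t3 a = a" for a
    by (simp_all add: t1_def t2_def t3_def)
  then show ?thesis
    using assms by (simp add: curve_def del: minus_pCons)
qed

text \<open>
  Restrict \<open>l * l\<^sup>N = A * g + B * h\<close> to the line \<open>l = 0\<close>. As \<open>g\<close> and \<open>h\<close> become coprime there, the
  resulting syzygy is a multiple \<open>c\<close> of the trivial one. Subtracting \<open>c\<close> times the trivial syzygy of \<open>g\<close> and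
  \<open>h\<close> makes both cofactors divisible by \<open>l\<close>, and one \<open>l\<close> can be cancelled.
\<close>

lemma comaximal_if_line_power_in_ideal:
  assumes n: "even n" "n > 0" and f: "curve n = g * h"
    and pow: "(t1 + t3) ^ N = A * g + B * h"
  shows "\<exists>A B. 1 = A * g + B * h"
  using pow
proof (induction N arbitrary: A B)
  case 0
  then show ?case by auto
next
  case (Suc N)
  define a :: "complex poly poly" where "a = - [:[:0, 1:]:]"
  have line: "t1 + t3 = [:- a, 1:]"
    by (simp add: t1_def t3_def a_def)
  have gh: "poly g a * poly h a = 2 * ([:[:0, 1:]:] ^ n + [:0, 1:] ^ n)"
    using curve_restricted_to_line[OF n(1)] by (simp add: f a_def)
  then have cop: "coprime (poly g a) (poly h a)"
    by (rule binary_form_factors_coprime[OF n(2)])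
  have "poly ([:[:0, 1:]:] ^ n + [:0, 1:] ^ n :: complex poly poly) 0 \<noteq> 0"
    using n by (simp add: zero_power)
  then have "[:[:0, 1:]:] ^ n + [:0, 1:] ^ n \<noteq> (0 :: complex poly poly)"
    by (rule contrapos_nn) (simp only: poly_0)
  then have "poly g a * poly h a \<noteq> 0"
    unfolding gh by (simp only: mult_eq_0_iff zero_neq_numeral[symmetric] simp_thms)
  then have nz: "poly h a \<noteq> 0"
    by auto
  have "poly ((t1 + t3) ^ Suc N) a = 0"
    by (simp add: line)
  then have zero: "poly A a * poly g a = - (poly B a * poly h a)"
    unfolding Suc.prems by (simp add: eq_neg_iff_add_eq_0)
  then have "poly h a dvd poly A a * poly g a"
    by simp
  then have "poly h a dvd poly A a"
    using cop by (simp add: coprime_commute coprime_dvd_mult_left_iff)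
  then obtain c where c: "poly A a = poly h a * c"
    by blast
  then have "poly h a * (poly B a + c * poly g a) = 0"
    using zero by (simp add: algebra_simps)
  then have c': "poly B a + c * poly g a = 0"
    using nz by simp
  have "poly (A - [:c:] * h) a = 0" "poly (B + [:c:] * g) a = 0"
    using c c' by (simp_all add: algebra_simps)
  then obtain A' B' where AB: "A - [:c:] * h = (t1 + t3) * A'" "B + [:c:] * g = (t1 + t3) * B'"
    unfolding poly_eq_0_iff_dvd line[symmetric] by (auto elim!: dvdE)
  have "(t1 + t3) * (t1 + t3) ^ N = (A - [:c:] * h) * g + (B + [:c:] * g) * h"
    using Suc.prems by (simp add: algebra_simps)
  also have "\<dots> = (t1 + t3) * (A' * g + B' * h)"
    unfolding AB by (simp add: algebra_simps)
  finally have "(t1 + t3) ^ N = A' * g + B' * h"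
    using line by (subst (asm) mult_left_cancel) auto
  then show ?case
    by (rule Suc.IH)
qed

text \<open>
  Setting \<open>t1 = t2 = 0\<close> in a coefficient; applied to all coefficients, it restricts a polynomial
  to the \<open>t3\<close>-axis.
\<close>

definition origin :: "complex poly poly \<Rightarrow> complex" where "origin p = poly (poly p 0) 0"

lemma origin_simps: "origin 0 = 0" "origin (p + q) = origin p + origin q"
    "origin (p * q) = origin p * origin q"
  by (simp_all add: origin_def)

lemma map_poly_origin_mult:
  "map_poly origin (p * q) = map_poly origin p * map_poly origin q"
proof (rule poly_eqI)
  have sum: "origin (sum f A) = (\<Sum>i\<in>A. origin (f i))" for f and A :: "nat set"
    by (induction A rule: infinite_finite_induct) (auto simp: origin_simps)
  show "coeff (map_poly origin (p * q)) k = coeff (map_poly origin p * map_poly origin q) k" for k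
    by (simp add: coeff_map_poly coeff_mult origin_simps sum)
qed

lemma origin_1: "origin 1 = 1"
  by (simp add: origin_def)

lemma map_poly_origin_power: "map_poly origin (p ^ n) = map_poly origin p ^ n"
  by (induction n) (simp_all add: map_poly_origin_mult map_poly_1 origin_1)

lemma map_poly_origin_curve:
  assumes "n > 0"
  shows "map_poly origin (curve n) = monom 2 n"
proof -
  have add: "map_poly origin (p + q) = map_poly origin p + map_poly origin q" for p q
    by (rule poly_eqI) (simp add: coeff_map_poly origin_simps)
  have "map_poly origin t1 = 0" "map_poly origin t2 = 0" "map_poly origin t3 = [:0, 1:]"
    by (simp_all add: t1_def t2_def t3_def map_poly_pCons origin_def)
  then show ?thesis
    using assms by (simp add: curve_def add map_poly_origin_power zero_power monom_altdef
        numeral_poly)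
qed

lemma
  assumes "n > 0"
  shows degree_curve: "degree (curve n) = n" and lead_coeff_curve: "lead_coeff (curve n) = 2"
proof -
  define s :: "complex poly poly" where "s = [:[:0, 1:], 1:]"
  have split: "curve n = [:[:[:0, 1:]:] ^ n + [:0, 1:] ^ n:] + [:0, 1:] ^ n + [:s, 1:] ^ n"
    by (simp add: curve_def t1_def t2_def t3_def s_def poly_const_pow)
  have top: "coeff ([:a, 1:] ^ n) n = 1" for a :: "complex poly poly"
    using lead_coeff_power[of "[:a, 1:]" n] by (simp add: degree_linear_power)
  have coeff: "coeff (curve n) n = 2"
    using assms top[of 0] top[of s]
    by (simp only: split coeff_add) (simp add: coeff_pCons split: nat.splits)
  moreover have "degree (curve n) \<le> n"
    unfolding split by (intro degree_add_le) (simp_all add: degree_linear_power)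
  ultimately show "degree (curve n) = n"
    using le_degree[of "curve n" n] by simp
  with coeff show "lead_coeff (curve n) = 2"
    by simp
qed

text \<open>
  At \<open>t1 = t2 = 0\<close> the factorization becomes one of \<open>2 * z\<^sup>n\<close>, so \<open>g\<close> restricts to a monomial \<open>c * z\<^sup>k\<close>. The
  curve has constant leading coefficient \<open>2\<close> in \<open>t3\<close>, so that of \<open>g\<close> is a unit and the restriction
  does not lower the degree. Thus \<open>k = 0\<close> only if \<open>g\<close> is a unit.
\<close>

lemma factor_vanishes_at_origin:
  assumes n: "n > 0" and f: "curve n = g * h" and g: "\<not> is_unit g"
  shows "poly (map_poly origin g) 0 = 0"
proof (rule ccontr)
  assume nz: "poly (map_poly origin g) 0 \<noteq> 0"
  let ?G = "map_poly origin g" and ?z = "[:0, 1:] :: complex poly"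
  have "?G * map_poly origin h = monom 2 n"
    using map_poly_origin_curve[OF n] by (simp add: f map_poly_origin_mult)
  also have "\<dots> = 2 * ?z ^ n"
    by (simp add: monom_altdef numeral_poly)
  finally have *: "?G * map_poly origin h = 2 * ?z ^ n" .
  have "?G dvd smult (1 / 2) (?G * map_poly origin h)"
    by (simp add: dvd_smult)
  then have dvd: "?G dvd ?z ^ n"
    unfolding * by (simp add: numeral_poly)
  have "prime_elem ?z"
    by (rule prime_elem_linear_poly) (simp, rule coprime_1_right)
  moreover have "\<not> ?z dvd ?G"
    using nz poly_eq_0_iff_dvd[of ?G 0] by simp
  ultimately have "coprime ?G ?z"
    by (metis prime_elem_imp_coprime coprime_commute)
  then have "coprime ?G (?z ^ n)"
    using n by (simp only: coprime_power_right_iff simp_thms)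
  then have "is_unit ?G"
    using dvd_refl dvd by (rule coprime_common_divisor)
  then have deg0: "degree ?G = 0"
    by (auto simp: is_unit_poly_iff)
  have "lead_coeff g * lead_coeff h = 2"
    using lead_coeff_curve[OF n] by (simp add: f lead_coeff_mult)
  then have unit: "lead_coeff g * (lead_coeff h * [:[:1/2:]:]) = 1"
    by (simp add: mult.assoc[symmetric] numeral_poly one_pCons)
  then have "origin (lead_coeff g) * origin (lead_coeff h * [:[:1/2:]:]) = 1"
    unfolding origin_simps(3)[symmetric] by (simp add: origin_def)
  then have "coeff ?G (degree g) \<noteq> 0"
    by (auto simp: coeff_map_poly origin_simps)
  with deg0 have "degree g = 0"
    by (metis le_degree le_zero_eq)
  then have "g = [:lead_coeff g:]"
    by (metis degree_0_id)
  moreover have "is_unit (lead_coeff g)"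
    using unit by (metis dvdI)
  ultimately have "is_unit g"
    by (metis is_unit_const_poly_iff)
  with g show False ..
qed

lemma prime_elem_curve:
  assumes n: "even n" "n > 0"
  shows "prime_elem (curve n)"
proof (rule irreducible_imp_prime_elem_gcd, rule comm_semiring_1_class.irreducibleI)
  show "curve n \<noteq> 0"
    using degree_curve[OF n(2)] n by auto
  show "\<not> is_unit (curve n)"
    using degree_curve[OF n(2)] n by (auto simp: is_unit_poly_iff)
  fix g h assume f: "curve n = g * h"
  show "is_unit g \<or> is_unit h"
  proof (rule ccontr)
    assume "\<not> (is_unit g \<or> is_unit h)"
    then have gh: "poly (map_poly origin g) 0 = 0" "poly (map_poly origin h) 0 = 0"
      using factor_vanishes_at_origin[OF n(2) f] factor_vanishes_at_origin[OF n(2), of h g] f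
      by (auto simp: mult.commute)
    obtain N A B where "(t1 + t3) ^ N = A * g + B * h"
      using line_in_radical_of_factors[OF n f] by blast
    then obtain A B where "1 = A * g + B * h"
      using comaximal_if_line_power_in_ideal[OF n f] by blast
    then have "origin (coeff 1 0) = origin (coeff (A * g + B * h) 0)"
      by simp
    also have "\<dots> = 0"
      using gh by (simp add: poly_0_coeff_0 coeff_map_poly origin_simps coeff_mult_0)
    finally show False
      by (simp add: origin_def)
  qed
qed

section \<open>Ideals of the polynomial ring in four variables\<close>

lemma S_simps [simp]:
  "carrier S = UNIV" "a \<otimes>\<^bsub>S\<^esub> b = a * b" "\<one>\<^bsub>S\<^esub> = 1"
  "\<zero>\<^bsub>S\<^esub> = 0" "a \<oplus>\<^bsub>S\<^esub> b = a + b"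
  by (simp_all add: S_def ring_of_type_algebra_def)

lemma cring_S: "cring S"
  unfolding S_def by (rule cring_from_type_algebra)

lemma ring_S: "ring S"
  using cring_S by (simp add: cring_def)

lemma ideal_SI:
  assumes "\<And>a b. a \<in> I \<Longrightarrow> b \<in> I \<Longrightarrow> a + b \<in> I" and "\<And>a b. a \<in> I \<Longrightarrow> b * a \<in> I" and "0 \<in> I"
  shows "ideal I S"
proof (rule idealI[OF ring_S])
  have "inv\<^bsub>add_monoid S\<^esub> a = - a" for a
  proof -
    interpret ring S by (rule ring_S)
    have "\<ominus>\<^bsub>S\<^esub> a = - a"
      by (rule minus_equality) simp_all
    then show ?thesis
      by (simp add: a_inv_def)
  qed
  moreover have "- a \<in> I" if "a \<in> I" for a
    using assms(2)[OF that, of "- 1"] by simp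
  ultimately show "subgroup I (add_monoid S)"
    using assms by (auto intro!: subgroup.intro)
qed (use assms in \<open>auto simp: mult.commute\<close>)

text \<open>
  The quotient map modulo \<open>p\<^sub>1\<close>, eliminating the outermost variable \<open>x\<^sub>4\<close>.
\<close>

definition restrict_hyperplane :: "poly4 \<Rightarrow> poly3"
  where "restrict_hyperplane F = poly F (- (t1 + t2 + t3))"

lemma restrict_hyperplane_power_sum:
  "even n \<Longrightarrow> restrict_hyperplane (power_sum n) = curve n"
proof -
  have "restrict_hyperplane x1 = t1" "restrict_hyperplane x2 = t2" "restrict_hyperplane x3 = t3"
    "restrict_hyperplane x4 = - (t1 + t2 + t3)"
    by (simp_all add: restrict_hyperplane_def x1_def x2_def x3_def x4_def t1_def t2_def t3_def)
  then show "even n \<Longrightarrow> restrict_hyperplane (power_sum n) = curve n"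
    unfolding restrict_hyperplane_def power_sum_def curve_def
    by (simp only: poly_add poly_power power_minus_even)
qed

lemma restrict_hyperplane_eq_0_iff:
  "restrict_hyperplane F = 0 \<longleftrightarrow> power_sum 1 dvd F"
proof -
  have "power_sum 1 = [:- (- (t1 + t2 + t3)), 1:]"
    by (simp add: power_sum_def x1_def x2_def x3_def x4_def t1_def t2_def t3_def)
  then show ?thesis
    unfolding restrict_hyperplane_def poly_eq_0_iff_dvd by simp
qed

text \<open>
  The case \<open>q = 0\<close> covers the ideal \<open>(p\<^sub>1)\<close>, the kernel of the restriction.
\<close>

lemma primeideal_restrict_hyperplane:
  assumes "q = 0 \<or> prime_elem q"
  shows "primeideal {F. q dvd restrict_hyperplane F} S"
proof (rule primeidealI)
  show "ideal {F. q dvd restrict_hyperplane F} S"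
    by (rule ideal_SI) (auto simp: restrict_hyperplane_def)
  show "cring S"
    by (rule cring_S)
  have "\<not> is_unit q"
    using assms by auto
  then have "1 \<notin> {F. q dvd restrict_hyperplane F}"
    by (simp add: restrict_hyperplane_def)
  then show "carrier S \<noteq> {F. q dvd restrict_hyperplane F}"
    by auto
  show "a \<in> {F. q dvd restrict_hyperplane F} \<or> b \<in> {F. q dvd restrict_hyperplane F}"
    if "a \<otimes>\<^bsub>S\<^esub> b \<in> {F. q dvd restrict_hyperplane F}" for a b
    using that assms by (auto simp: restrict_hyperplane_def prime_elem_dvd_mult_iff)
qed

lemma Idl_power_sum_1: "Idl\<^bsub>S\<^esub> {power_sum 1} = {F. 0 dvd restrict_hyperplane F}"
proof -
  interpret cring S by (rule cring_S)
  show ?thesis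
    using cgenideal_eq_genideal[of "power_sum 1", symmetric]
    by (auto simp: cgenideal_def restrict_hyperplane_eq_0_iff mult.commute[of _ "power_sum _"]
        elim!: dvdE)
qed

text \<open>
  If \<open>F\<close> restricts to \<open>k * curve n\<close>, then lifting \<open>k\<close> to a polynomial that is constant in \<open>x\<^sub>4\<close> gives
  \<open>F - k * p\<^sub>n\<close> in the kernel of the restriction, which is generated by \<open>p\<^sub>1\<close>.
\<close>

lemma Idl_power_sum_1_even:
  assumes "even n"
  shows "Idl\<^bsub>S\<^esub> {power_sum 1, power_sum n} = {F. curve n dvd restrict_hyperplane F}"
proof
  interpret cring S by (rule cring_S)
  let ?J = "Idl\<^bsub>S\<^esub> {power_sum 1, power_sum n}"
  have "ideal {F. curve n dvd restrict_hyperplane F} S"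
    by (rule ideal_SI) (auto simp: restrict_hyperplane_def)
  then show "?J \<subseteq> {F. curve n dvd restrict_hyperplane F}"
    using restrict_hyperplane_power_sum[OF assms] restrict_hyperplane_eq_0_iff[of "power_sum 1"]
    by (intro genideal_minimal) auto
  interpret J: ideal ?J S
    by (rule genideal_ideal) simp
  have gen: "power_sum 1 \<in> ?J" "power_sum n \<in> ?J"
    using genideal_self[of "{power_sum 1, power_sum n}"] by auto
  show "{F. curve n dvd restrict_hyperplane F} \<subseteq> ?J"
  proof clarify
    fix F assume "curve n dvd restrict_hyperplane F"
    then obtain k where k: "restrict_hyperplane F = curve n * k"
      by blast
    have "restrict_hyperplane (F - [:k:] * power_sum n)
        = restrict_hyperplane F - k * restrict_hyperplane (power_sum n)"
      by (simp add: restrict_hyperplane_def)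
    then have "power_sum 1 dvd F - [:k:] * power_sum n"
      unfolding restrict_hyperplane_eq_0_iff[symmetric]
      by (simp add: k restrict_hyperplane_power_sum[OF assms])
    then obtain G where "F - [:k:] * power_sum n = power_sum 1 * G"
      by blast
    then have "F = [:k:] * power_sum n + G * power_sum 1"
      by (simp add: algebra_simps)
    also have "\<dots> \<in> ?J"
      using J.a_closed[OF J.I_l_closed[OF gen(2)] J.I_l_closed[OF gen(1)]]
      by (simp only: S_simps UNIV_I simp_thms)
    finally show "F \<in> ?J" .
  qed
qed

text \<open>All power sums of positive degree vanish at the origin.\<close>

lemma Idl_power_sums_proper:
  assumes "0 \<notin> N"
  shows "Idl\<^bsub>S\<^esub> (power_sum ` N) \<noteq> carrier S"
proof -
  interpret cring S by (rule cring_S)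
  let ?v = "\<lambda>F :: poly4. poly (poly (poly (poly F 0) 0) 0) 0"
  have "ideal {F. ?v F = 0} S"
    by (rule ideal_SI) auto
  moreover have "power_sum ` N \<subseteq> {F. ?v F = 0}"
  proof clarify
    fix n assume "n \<in> N"
    then have "n > 0"
      using assms by (cases n) auto
    then show "?v (power_sum n) = 0"
      by (simp add: power_sum_def x1_def x2_def x3_def x4_def poly_power zero_power)
  qed
  ultimately have "Idl\<^bsub>S\<^esub> (power_sum ` N) \<subseteq> {F. ?v F = 0}"
    by (rule genideal_minimal)
  then have "1 \<notin> Idl\<^bsub>S\<^esub> (power_sum ` N)"
    by auto
  then show ?thesis
    by auto
qed

lemma nonzerodivisor_mod_prime:
  assumes "primeideal P R" "a \<in> carrier R" "a \<notin> P"
  shows "nonzerodivisor (R Quot P) (P +>\<^bsub>R\<^esub> a)"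
proof -
  interpret P: primeideal P R by fact
  interpret Q: domain "R Quot P" by (rule P.quotient_is_domain)
  have "P +>\<^bsub>R\<^esub> a \<in> carrier (R Quot P)"
    using assms(2) by (auto simp: FactRing_def A_RCOSETS_def')
  moreover have "P +>\<^bsub>R\<^esub> a \<noteq> \<zero>\<^bsub>R Quot P\<^esub>"
    using P.a_rcos_self[OF assms(2)] assms(3) by (auto simp: FactRing_def)
  ultimately show ?thesis
    unfolding nonzerodivisor_def using Q.integral_iff by blast
qed

lemma restrict_hyperplane_power_sum_neq_0:
  "n > 0 \<Longrightarrow> even n \<Longrightarrow> restrict_hyperplane (power_sum n) \<noteq> 0"
  using prime_elem_curve[of n] by (auto simp: restrict_hyperplane_power_sum)

theorem proposition4p7:
  fixes m :: nat
  assumes "m > 0"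
  shows "primeideal (Idl\<^bsub>S\<^esub> {power_sum 1, power_sum (2 * m)}) S \<and>
    (\<forall>n::nat. n > 2 * m \<longrightarrow> power_sum n \<notin> Idl\<^bsub>S\<^esub> {power_sum 1, power_sum (2 * m)} \<longrightarrow>
      regular_sequence S [power_sum 1, power_sum (2 * m), power_sum n])"
proof (intro conjI allI impI)
  have prime2: "primeideal (Idl\<^bsub>S\<^esub> {power_sum 1, power_sum (2 * m)}) S"
    using assms by (subst Idl_power_sum_1_even)
      (auto intro!: primeideal_restrict_hyperplane prime_elem_curve)
  then show "primeideal (Idl\<^bsub>S\<^esub> {power_sum 1, power_sum (2 * m)}) S" .
  fix n :: nat
  assume n: "n > 2 * m" "power_sum n \<notin> Idl\<^bsub>S\<^esub> {power_sum 1, power_sum (2 * m)}"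
  have prime1: "primeideal (Idl\<^bsub>S\<^esub> {power_sum 1}) S"
    unfolding Idl_power_sum_1 by (rule primeideal_restrict_hyperplane) simp
  have "domain S"
    using cring_S by (auto intro!: domain.intro domain_axioms.intro)
  then have prime0: "primeideal (Idl\<^bsub>S\<^esub> {}) S" and Idl0: "Idl\<^bsub>S\<^esub> {} = {0}"
  proof -
    interpret domain S by fact
    show "Idl\<^bsub>S\<^esub> {} = {0}"
      using genideal_minimal[OF zeroideal, of "{}"] additive_subgroup.zero_closed[OF ideal.axioms(1)[OF genideal_ideal[of "{}"]]]
      by auto
    then show "primeideal (Idl\<^bsub>S\<^esub> {}) S"
      using zeroprimeideal by simp
  qed
  let ?fs = "[power_sum 1, power_sum (2 * m), power_sum n]"
  have "nonzerodivisor (S Quot Idl\<^bsub>S\<^esub> (set (take i ?fs))) (Idl\<^bsub>S\<^esub> (set (take i ?fs)) +>\<^bsub>S\<^esub> ?fs ! i)"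
    if "i < length ?fs" for i
  proof -
    consider "i = 0" | "i = 1" | "i = 2"
      using \<open>i < length ?fs\<close> by fastforce
    then show ?thesis
    proof cases
      case 1
      have "power_sum 1 \<noteq> 0"
        by (simp add: power_sum_def x1_def x2_def x3_def x4_def)
      then show ?thesis
        using nonzerodivisor_mod_prime[OF prime0, of "power_sum 1"] by (simp add: 1 Idl0)
    next
      case 2
      have "power_sum (2 * m) \<notin> Idl\<^bsub>S\<^esub> {power_sum 1}"
        unfolding Idl_power_sum_1 using restrict_hyperplane_power_sum_neq_0[of "2 * m"] assms by simp
      then show ?thesis
        using nonzerodivisor_mod_prime[OF prime1, of "power_sum (2 * m)"] by (simp add: 2)
    next
      case 3
      then show ?thesis
        using nonzerodivisor_mod_prime[OF prime2, of "power_sum n"] n by (simp add: numeral_2_eq_2)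
    qed
  qed
  moreover have "Idl\<^bsub>S\<^esub> (set ?fs) \<noteq> carrier S"
    using Idl_power_sums_proper[of "{1, 2 * m, n}"] assms n(1) by simp
  ultimately show "regular_sequence S ?fs"
    unfolding regular_sequence_def by simp
qed

end
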